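(* Let $V$ be a finite set and let $f,g:V\to\mathbb{R}$ be two real functions on $V$. Let $n\ge 0$. Then the following identities of linear maps defined on $\Lambda_n(V)$ hold, for all indices for which the left-hand side is defined. (i) For all $0\le i<j\le n$: $\partial_i^f\circ\partial_j^g=-\,\partial_{j-1}^g\circ\partial_i^f$. (ii) For all $0\le i,j\le n+1$: $$\partial_i^f\circ d_j^g=\begin{cases}-\,d_{j-1}^g\circ\partial_i^f, & i<j,\\ \langle f,g\rangle\,\mathrm{id}, & i=j,\\ -\,d_j^g\circ\partial_{i-1}^f, & i>j.\end{cases}$$ (iii) For all $0\le i\le j\le n+1$: $d_i^f\circ d_j^g=-\,d_{j+1}^g\circ d_i^f$.
   Context: For an integer $n\ge 0$, an elementary $n$-path on $V$ is an ordered sequence $v_0v_1\ldots v_n$ of vertices of $V$ (repetitions allowed), and $\Lambda_n(V)$ is the real vector space with basis the set of all elementary $n$-paths on $V$. Convention: $\Lambda_{-1}(V)=\mathbb{R}e$ is one-dimensional, spanned by the empty path $e$. For $v,u\in V$ let $\delta(v,u)=1$ if $v=u$ and $0$ otherwise. For $v\in V$ and $0\le i\le n$ define the linear map $\frac{\partial_i}{\partial v}:\Lambda_n(V)\to\Lambda_{n-1}(V)$ by $\frac{\partial_i}{\partial v}(v_0\ldots v_n)=(-1)^i\delta(v,v_i)\,v_0\ldots\widehat{v_i}\ldots v_n$, where the hat means omission (for $n=0$: $\frac{\partial_0}{\partial v}(v_0)=\delta(v,v_0)e$). For $0\le i\le n+1$ define the linear map $d_iv:\Lambda_n(V)\to\Lambda_{n+1}(V)$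 by $d_iv(v_0\ldots v_n)=(-1)^i\,v_0\ldots v_{i-1}\,v\,v_i\ldots v_n$ (the vertex $v$ is inserted so as to occupy position $i$; on the empty path, $d_0v(e)=v$). For a function $f:V\to\mathbb{R}$, the $i$-th $f$-weighted face map is $\partial_i^f=\sum_{v\in V}f(v)\frac{\partial_i}{\partial v}:\Lambda_n(V)\to\Lambda_{n-1}(V)$, $0\le i\le n$, and the $i$-th $f$-weighted co-face map is $d_i^f=\sum_{v\in V}f(v)\,d_iv:\Lambda_n(V)\to\Lambda_{n+1}(V)$, $0\le i\le n+1$. Finally $\langle f,g\rangle=\sum_{v\in V}f(v)g(v)$. *)

theory Defs
  imports "HOL-Analysis.Finite_Function_Topology"
begin

text \<open>An elementary path \<open>v\<^sub>0 \<dots> v\<^sub>n\<close> is the list of its \<open>n + 1\<close> vertices, so the empty path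
  \<open>e\<close> is the empty list. All the spaces \<open>\<Lambda>\<^sub>n(V)\<close> are subspaces of one ambient real vector space,
  the free vector space \<open>'v list \<Rightarrow>\<^sub>0 real\<close> on lists. The degree is an integer, so that
  \<open>\<Lambda>\<^sub>-\<^sub>1(V)\<close> is covered as the span of the empty path.\<close>

definition elem_paths :: "'v set \<Rightarrow> int \<Rightarrow> 'v list set" where
  "elem_paths V n = {p. set p \<subseteq> V \<and> int (length p) = n + 1}"

definition path_vec :: "'v list \<Rightarrow> 'v list \<Rightarrow>\<^sub>0 real" where
  "path_vec p = Poly_Mapping.single p 1"

definition path_space :: "'v set \<Rightarrow> int \<Rightarrow> ('v list \<Rightarrow>\<^sub>0 real) set" where
  "path_space V n = span (path_vec ` elem_paths V n)"

definition lin_extend :: "('v list \<Rightarrow> 'v list \<Rightarrow>\<^sub>0 real) \<Rightarrow> ('v list \<Rightarrow>\<^sub>0 real) \<Rightarrow> ('v list \<Rightarrow>\<^sub>0 real)" where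
  "lin_extend b x = (\<Sum>p\<in>Poly_Mapping.keys x. Poly_Mapping.lookup x p *\<^sub>R b p)"

definition vdelta :: "'v \<Rightarrow> 'v \<Rightarrow> real" where
  "vdelta v u = (if v = u then 1 else 0)"

text \<open>The maps below are total on the ambient space. On \<open>\<Lambda>\<^sub>n(V)\<close> the map \<open>vertex_partial v i\<close>
  is meaningful for \<open>i \<le> n\<close> and \<open>vertex_insert v i\<close> for \<open>i \<le> n + 1\<close>; outside these ranges
  their values are arbitrary.\<close>

definition vertex_partial :: "'v \<Rightarrow> nat \<Rightarrow> ('v list \<Rightarrow>\<^sub>0 real) \<Rightarrow> ('v list \<Rightarrow>\<^sub>0 real)" where
  "vertex_partial v i =
    lin_extend (\<lambda>p. ((-1) ^ i * vdelta v (p ! i)) *\<^sub>R path_vec (take i p @ drop (Suc i) p))"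

definition vertex_insert :: "'v \<Rightarrow> nat \<Rightarrow> ('v list \<Rightarrow>\<^sub>0 real) \<Rightarrow> ('v list \<Rightarrow>\<^sub>0 real)" where
  "vertex_insert v i = lin_extend (\<lambda>p. (-1) ^ i *\<^sub>R path_vec (take i p @ v # drop i p))"

definition face :: "'v set \<Rightarrow> ('v \<Rightarrow> real) \<Rightarrow> nat \<Rightarrow> ('v list \<Rightarrow>\<^sub>0 real) \<Rightarrow> ('v list \<Rightarrow>\<^sub>0 real)" where
  "face V f i x = (\<Sum>v\<in>V. f v *\<^sub>R vertex_partial v i x)"

definition coface :: "'v set \<Rightarrow> ('v \<Rightarrow> real) \<Rightarrow> nat \<Rightarrow> ('v list \<Rightarrow>\<^sub>0 real) \<Rightarrow> ('v list \<Rightarrow>\<^sub>0 real)" where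
  "coface V f i x = (\<Sum>v\<in>V. f v *\<^sub>R vertex_insert v i x)"

definition fun_inner :: "'v set \<Rightarrow> ('v \<Rightarrow> real) \<Rightarrow> ('v \<Rightarrow> real) \<Rightarrow> real" where
  "fun_inner V f g = (\<Sum>v\<in>V. f v * g v)"


text \<open>Sanity checks: the elementary paths are a basis, \<open>lin_extend\<close> is linear extension from that
  basis, and the (co-)face maps are linear maps between the spaces of the expected degrees.\<close>

lemma lookup_scaleR: "Poly_Mapping.lookup (c *\<^sub>R x) p = c *\<^sub>R Poly_Mapping.lookup x p"
proof -
  have "finite {p. c *\<^sub>R Poly_Mapping.lookup x p \<noteq> 0}"
    by (rule finite_subset[of _ "Poly_Mapping.keys x"]) (auto simp: in_keys_iff)
  then show ?thesis
    by (simp add: scaleR_poly_mapping_def)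
qed

lemma lin_extend_superset:
  assumes "finite A" "Poly_Mapping.keys x \<subseteq> A"
  shows "lin_extend b x = (\<Sum>p\<in>A. Poly_Mapping.lookup x p *\<^sub>R b p)"
  unfolding lin_extend_def using assms
  by (intro sum.mono_neutral_left) (auto simp: in_keys_iff)

lemma linear_lin_extend: "linear (lin_extend b)"
proof (rule linearI)
  fix x y :: "'a list \<Rightarrow>\<^sub>0 real" and c :: real
  let ?A = "Poly_Mapping.keys x \<union> Poly_Mapping.keys y"
  have fin: "finite ?A" by simp
  show "lin_extend b (x + y) = lin_extend b x + lin_extend b y"
    using keys_add[of x y]
    by (simp add: lin_extend_superset[OF fin] lookup_add scaleR_add_left sum.distrib)
  have "Poly_Mapping.keys (c *\<^sub>R x) \<subseteq> Poly_Mapping.keys x"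
    by (auto simp: in_keys_iff lookup_scaleR)
  then show "lin_extend b (c *\<^sub>R x) = c *\<^sub>R lin_extend b x"
    by (simp add: lin_extend_superset[of "Poly_Mapping.keys x"] lookup_scaleR scaleR_sum_right)
qed

lemma lin_extend_path_vec [simp]: "lin_extend b (path_vec p) = b p"
  by (simp add: lin_extend_def path_vec_def)

lemma inj_path_vec: "inj path_vec"
proof (rule injI)
  fix p q :: "'a list"
  assume "path_vec p = path_vec q"
  then have "Poly_Mapping.keys (path_vec p) = Poly_Mapping.keys (path_vec q)" by simp
  then show "p = q" by (simp add: path_vec_def)
qed

lemma independent_path_vec: "independent (path_vec ` elem_paths V n)"
  unfolding independent_explicit_module
proof (intro allI impI)
  fix t u v
  assume t: "finite t" "t \<subseteq> path_vec ` elem_paths V n" "(\<Sum>v\<in>t. u v *\<^sub>R v) = 0" "v \<in> t"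
  then obtain p where p: "v = path_vec p" by auto
  have "0 = Poly_Mapping.lookup (\<Sum>v\<in>t. u v *\<^sub>R v) p" using t by simp
  also have "\<dots> = (\<Sum>w\<in>t. u w * Poly_Mapping.lookup w p)"
    by (simp add: lookup_sum lookup_scaleR)
  also have "\<dots> = (\<Sum>w\<in>{v}. u w * Poly_Mapping.lookup w p)"
  proof (intro sum.mono_neutral_right ballI)
    fix w assume w: "w \<in> t - {v}"
    then obtain q where "w = path_vec q" using t by auto
    with w p show "u w * Poly_Mapping.lookup w p = 0"
      by (auto simp: path_vec_def lookup_single when_def)
  qed (use t in auto)
  also have "\<dots> = u v" by (simp add: p path_vec_def)
  finally show "u v = 0" by simp
qed

lemma linear_face: "linear (face V f i)"
  unfolding face_def vertex_partial_def
  by (intro linear_compose_sum ballI linear_compose_scale_right linear_lin_extend)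

lemma linear_coface: "linear (coface V f i)"
  unfolding coface_def vertex_insert_def
  by (intro linear_compose_sum ballI linear_compose_scale_right linear_lin_extend)

lemma linear_maps_path_space:
  assumes "linear h" "\<And>p. p \<in> elem_paths V m \<Longrightarrow> h (path_vec p) \<in> path_space V k"
    and "x \<in> path_space V m"
  shows "h x \<in> path_space V k"
proof -
  have "h x \<in> h ` span (path_vec ` elem_paths V m)"
    using assms(3) by (simp add: path_space_def)
  also have "\<dots> = span (h ` path_vec ` elem_paths V m)"
    by (rule linear_span_image[OF assms(1), symmetric])
  also have "\<dots> \<subseteq> path_space V k"
    unfolding path_space_def
    by (rule span_minimal) (use assms(2) in \<open>auto simp: path_space_def\<close>)
  finally show ?thesis .
qed

lemma face_in_path_space:
  assumes "i \<le> n" "x \<in> path_space V (int n)"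
  shows "face V f i x \<in> path_space V (int n - 1)"
proof (rule linear_maps_path_space[OF linear_face _ assms(2)])
  fix p assume p: "p \<in> elem_paths V (int n)"
  then have "take i p @ drop (Suc i) p \<in> elem_paths V (int n - 1)"
    using assms(1) set_take_subset[of i p] set_drop_subset[of "Suc i" p]
    by (auto simp: elem_paths_def)
  then show "face V f i (path_vec p) \<in> path_space V (int n - 1)"
    unfolding face_def vertex_partial_def path_space_def
    by (auto intro!: span_sum span_scale intro: span_base)
qed

lemma coface_in_path_space:
  assumes "int i \<le> n + 1" "x \<in> path_space V n"
  shows "coface V f i x \<in> path_space V (n + 1)"
proof (rule linear_maps_path_space[OF linear_coface _ assms(2)])
  fix p assume p: "p \<in> elem_paths V n"
  have "take i p @ v # drop i p \<in> elem_paths V (n + 1)" if "v \<in> V" for v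
    using that p assms(1) set_take_subset[of i p] set_drop_subset[of i p]
    by (auto simp: elem_paths_def)
  then show "coface V f i (path_vec p) \<in> path_space V (n + 1)"
    unfolding coface_def vertex_insert_def path_space_def
    by (auto intro!: span_sum span_scale intro: span_base)
qed

end

theory Submission
  imports Defs
begin

text \<open>All the maps are linear, so it suffices to compare both sides on an elementary path \<open>p\<close>.
  There \<open>\<partial>\<^sub>i\<^sup>f\<close> deletes the entry at position \<open>i\<close> with weight \<open>(-1)\<^sup>i f(p\<^sub>i)\<close>
  (\<open>face_path_vec\<close>), and \<open>d\<^sub>i\<^sup>f\<close> is the sum over \<open>v \<in> V\<close> of the insertions of \<open>v\<close> at position \<open>i\<close>
  with weight \<open>(-1)\<^sup>i f(v)\<close> (\<open>coface_path_vec\<close>). The list operations behind the two maps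
  commute, except that passing one of them across the other changes the position further to the
  right by one. The entries read off by the deletions, and hence the weights from \<open>f\<close> and \<open>g\<close>,
  are the same in either order, while the shift contributes the sign \<open>-1\<close>. The exceptional case is
  deletion at the position of an insertion: it restores the list, and the weights
  \<open>(-1)\<^sup>i f(v) (-1)\<^sup>i g(v)\<close> then sum to \<open>\<langle>f, g\<rangle>\<close>.\<close>

text \<open>The list \<open>p\<close> without its entry at position \<open>i\<close>, counted from \<open>0\<close>; it is \<open>p\<close> itself if
  \<open>i \<ge> length p\<close>.\<close>

definition remove_nth :: "nat \<Rightarrow> 'a list \<Rightarrow> 'a list" where
  "remove_nth i p = take i p @ drop (Suc i) p"

text \<open>The list \<open>p\<close> with \<open>v\<close> inserted so as to occupy position \<open>i\<close>. The position \<open>i = length p\<close>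
  is allowed and appends \<open>v\<close>; larger \<open>i\<close> append it as well.\<close>

definition insert_nth :: "'a \<Rightarrow> nat \<Rightarrow> 'a list \<Rightarrow> 'a list" where
  "insert_nth v i p = take i p @ v # drop i p"

lemma remove_nth_Cons [simp]:
  "remove_nth 0 (a # p) = p" "remove_nth (Suc i) (a # p) = a # remove_nth i p"
  by (simp_all add: remove_nth_def)

lemma insert_nth_0 [simp]: "insert_nth v 0 p = v # p"
  by (simp add: insert_nth_def)

lemma insert_nth_Suc_Cons [simp]: "insert_nth v (Suc i) (a # p) = a # insert_nth v i p"
  by (simp add: insert_nth_def)

lemma length_remove_nth: "i < length p \<Longrightarrow> length (remove_nth i p) = length p - 1"
  by (simp add: remove_nth_def)

lemma set_remove_nth_subset: "set (remove_nth i p) \<subseteq> set p"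
  using set_take_subset[of i p] set_drop_subset[of "Suc i" p] by (auto simp: remove_nth_def)

lemma length_insert_nth [simp]: "length (insert_nth v i p) = Suc (length p)"
  by (simp add: insert_nth_def)

lemma set_insert_nth [simp]: "set (insert_nth v i p) = insert v (set p)"
proof -
  have "set p = set (take i p) \<union> set (drop i p)"
    by (metis append_take_drop_id set_append)
  then show ?thesis by (simp add: insert_nth_def)
qed

lemma nth_remove_nth_left: "i < j \<Longrightarrow> j < length p \<Longrightarrow> remove_nth j p ! i = p ! i"
  by (simp add: remove_nth_def nth_append)

lemma nth_remove_nth_right: "i \<le> j \<Longrightarrow> Suc j < length p \<Longrightarrow> remove_nth i p ! j = p ! Suc j"
  by (simp add: remove_nth_def nth_append)

lemma nth_insert_nth_left: "i < j \<Longrightarrow> j \<le> length p \<Longrightarrow> insert_nth v j p ! i = p ! i"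
  by (simp add: insert_nth_def nth_append)

lemma nth_insert_nth_same: "i \<le> length p \<Longrightarrow> insert_nth v i p ! i = v"
  by (simp add: insert_nth_def nth_append)

lemma nth_insert_nth_right:
  "j \<le> i \<Longrightarrow> i < length p \<Longrightarrow> insert_nth v j p ! Suc i = p ! i"
  by (simp add: insert_nth_def nth_append Suc_diff_le)

lemma remove_nth_remove_nth:
  "i \<le> j \<Longrightarrow> remove_nth i (remove_nth (Suc j) p) = remove_nth j (remove_nth i p)"
proof (induction p arbitrary: i j)
  case (Cons a p)
  then show ?case by (cases i; cases j) auto
qed (simp add: remove_nth_def)

lemma remove_nth_insert_nth_left:
  "i \<le> j \<Longrightarrow> j < length p \<Longrightarrow>
    remove_nth i (insert_nth v (Suc j) p) = insert_nth v j (remove_nth i p)"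
proof (induction p arbitrary: i j)
  case (Cons a p)
  then show ?case by (cases i; cases j) auto
qed simp

lemma remove_nth_insert_nth_same: "i \<le> length p \<Longrightarrow> remove_nth i (insert_nth v i p) = p"
  by (simp add: remove_nth_def insert_nth_def)

lemma remove_nth_insert_nth_right:
  "j \<le> i \<Longrightarrow> i < length p \<Longrightarrow>
    remove_nth (Suc i) (insert_nth v j p) = insert_nth v j (remove_nth i p)"
proof (induction p arbitrary: i j)
  case (Cons a p)
  then show ?case by (cases i; cases j) auto
qed simp

lemma insert_nth_insert_nth:
  "i \<le> j \<Longrightarrow> j \<le> length p \<Longrightarrow>
    insert_nth u i (insert_nth v j p) = insert_nth v (Suc j) (insert_nth u i p)"
proof (induction p arbitrary: i j)
  case (Cons a p)
  then show ?case by (cases i; cases j) auto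
qed (simp add: insert_nth_def)

lemma path_space_linear_eqI:
  assumes "x \<in> path_space V m" "linear F" "linear G"
    and "\<And>p. set p \<subseteq> V \<Longrightarrow> int (length p) = m + 1 \<Longrightarrow> F (path_vec p) = G (path_vec p)"
  shows "F x = G x"
proof (rule linear_eq_on_span[OF assms(2,3)])
  show "x \<in> span (path_vec ` elem_paths V m)"
    using assms(1) by (simp add: path_space_def)
qed (use assms(4) in \<open>auto simp: elem_paths_def\<close>)

lemma face_path_vec:
  assumes "finite V" "set p \<subseteq> V" "i < length p"
  shows "face V f i (path_vec p) = ((-1) ^ i * f (p ! i)) *\<^sub>R path_vec (remove_nth i p)"
proof -
  have "p ! i \<in> V" using assms nth_mem by blast
  have "face V f i (path_vec p) =
      (\<Sum>v\<in>V. if v = p ! i then ((-1) ^ i * f v) *\<^sub>R path_vec (remove_nth i p) else 0)"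
    unfolding face_def vertex_partial_def
    by (intro sum.cong) (auto simp: vdelta_def remove_nth_def)
  with \<open>p ! i \<in> V\<close> show ?thesis using assms(1) by simp
qed

lemma coface_path_vec:
  "coface V f i (path_vec p) = (\<Sum>v\<in>V. ((-1) ^ i * f v) *\<^sub>R path_vec (insert_nth v i p))"
  unfolding coface_def vertex_insert_def
  by (intro sum.cong) (auto simp: insert_nth_def)

lemma face_scaleR: "face V f i (c *\<^sub>R x) = c *\<^sub>R face V f i x"
  by (rule linear_scale[OF linear_face])

lemma face_minus: "face V f i (- x) = - face V f i x"
  by (rule linear_neg[OF linear_face])

lemma face_sum: "face V f i (\<Sum>a\<in>A. h a) = (\<Sum>a\<in>A. face V f i (h a))"
  by (rule linear_sum[OF linear_face])

lemma coface_scaleR: "coface V f i (c *\<^sub>R x) = c *\<^sub>R coface V f i x"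
  by (rule linear_scale[OF linear_coface])

lemma coface_sum: "coface V f i (\<Sum>a\<in>A. h a) = (\<Sum>a\<in>A. coface V f i (h a))"
  by (rule linear_sum[OF linear_coface])

lemma linear_face_face: "linear (\<lambda>x. face V f i (face U g j x))"
  using linear_compose[OF linear_face linear_face] by (simp add: o_def)

lemma linear_face_coface: "linear (\<lambda>x. face V f i (coface U g j x))"
  using linear_compose[OF linear_coface linear_face] by (simp add: o_def)

lemma linear_coface_face: "linear (\<lambda>x. coface V f i (face U g j x))"
  using linear_compose[OF linear_face linear_coface] by (simp add: o_def)

lemma linear_coface_coface: "linear (\<lambda>x. coface V f i (coface U g j x))"
  using linear_compose[OF linear_coface linear_coface] by (simp add: o_def)

text \<open>In the relations below an index that is lowered on the other side is written as a successor,
  so that no truncated subtraction occurs. The degree \<open>m\<close> is an integer, so that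
  \<open>face_coface_same\<close> and \<open>coface_coface\<close> also cover \<open>\<Lambda>\<^sub>-\<^sub>1(V)\<close>.\<close>

lemma face_face:
  assumes "finite V" "i \<le> j" "int (Suc j) \<le> m" "x \<in> path_space V m"
  shows "face V f i (face V g (Suc j) x) = - face V g j (face V f i x)"
proof (rule path_space_linear_eqI[OF assms(4)])
  fix p assume p: "set p \<subseteq> V" "int (length p) = m + 1"
  have len: "Suc j < length p" using p assms by linarith
  have sub: "set (remove_nth k p) \<subseteq> V" for k
    using set_remove_nth_subset p(1) by (rule order_trans)
  show "face V f i (face V g (Suc j) (path_vec p)) = - face V g j (face V f i (path_vec p))"
    using assms(1,2) p(1) len sub
    by (simp add: face_path_vec face_scaleR face_minus length_remove_nth nth_remove_nth_left
        nth_remove_nth_right remove_nth_remove_nth mult_ac)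
qed (intro linear_face_face linear_compose_neg)+

lemma face_coface_left:
  assumes "finite V" "i \<le> j" "int j \<le> m" "x \<in> path_space V m"
  shows "face V f i (coface V g (Suc j) x) = - coface V g j (face V f i x)"
proof (rule path_space_linear_eqI[OF assms(4)])
  fix p assume p: "set p \<subseteq> V" "int (length p) = m + 1"
  have len: "j < length p" using p assms by linarith
  show "face V f i (coface V g (Suc j) (path_vec p)) = - coface V g j (face V f i (path_vec p))"
    using assms(1,2) p(1) len
    by (simp add: face_path_vec coface_path_vec face_scaleR coface_scaleR face_minus
        face_sum nth_insert_nth_left remove_nth_insert_nth_left scaleR_sum_right sum_negf mult_ac)
qed (intro linear_face_coface linear_coface_face linear_compose_neg)+

lemma face_coface_same:
  assumes "finite V" "int i \<le> m + 1" "x \<in> path_space V m"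
  shows "face V f i (coface V g i x) = fun_inner V f g *\<^sub>R x"
proof (rule path_space_linear_eqI[OF assms(3)])
  fix p assume p: "set p \<subseteq> V" "int (length p) = m + 1"
  have len: "i \<le> length p" using p assms by linarith
  \<comment> \<open>the two signs, from the insertion and from the deletion at the same position, cancel\<close>
  have sign: "(-1) ^ i * ((-1) ^ i * c) = c" for c :: real
    by (simp flip: mult.assoc power_add)
  show "face V f i (coface V g i (path_vec p)) = fun_inner V f g *\<^sub>R path_vec p"
    using assms(1) p(1) len
    by (simp add: face_path_vec coface_path_vec face_scaleR face_sum nth_insert_nth_same
        remove_nth_insert_nth_same fun_inner_def scaleR_sum_left sign mult_ac)
qed (intro linear_face_coface linear_scale_self)+

lemma face_coface_right:
  assumes "finite V" "j \<le> i" "int i \<le> m" "x \<in> path_space V m"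
  shows "face V f (Suc i) (coface V g j x) = - coface V g j (face V f i x)"
proof (rule path_space_linear_eqI[OF assms(4)])
  fix p assume p: "set p \<subseteq> V" "int (length p) = m + 1"
  have len: "i < length p" using p assms by linarith
  show "face V f (Suc i) (coface V g j (path_vec p)) = - coface V g j (face V f i (path_vec p))"
    using assms(1,2) p(1) len
    by (simp add: face_path_vec coface_path_vec face_scaleR coface_scaleR face_minus
        face_sum nth_insert_nth_right remove_nth_insert_nth_right scaleR_sum_right sum_negf mult_ac)
qed (intro linear_face_coface linear_coface_face linear_compose_neg)+

lemma coface_coface:
  assumes "i \<le> j" "int j \<le> m + 1" "x \<in> path_space V m"
  shows "coface V f i (coface V g j x) = - coface V g (Suc j) (coface V f i x)"
proof (rule path_space_linear_eqI[OF assms(3)])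
  fix p assume p: "set p \<subseteq> V" "int (length p) = m + 1"
  have len: "j \<le> length p" using p assms by linarith
  \<comment> \<open>each side is a double sum over the pairs of inserted vertices, in opposite orders of summation\<close>
  have "coface V f i (coface V g j (path_vec p)) =
      (\<Sum>v\<in>V. \<Sum>u\<in>V. ((-1) ^ j * g v * ((-1) ^ i * f u)) *\<^sub>R
        path_vec (insert_nth u i (insert_nth v j p)))"
    by (simp add: coface_path_vec coface_scaleR coface_sum scaleR_sum_right)
  also have "\<dots> = (\<Sum>u\<in>V. \<Sum>v\<in>V. ((-1) ^ j * g v * ((-1) ^ i * f u)) *\<^sub>R
        path_vec (insert_nth u i (insert_nth v j p)))"
    by (rule sum.swap)
  also have "\<dots> = - coface V g (Suc j) (coface V f i (path_vec p))"
    using assms(1) len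
    by (simp add: coface_path_vec coface_scaleR coface_sum scaleR_sum_right
        insert_nth_insert_nth sum_negf mult_ac)
  finally show "coface V f i (coface V g j (path_vec p)) =
      - coface V g (Suc j) (coface V f i (path_vec p))" .
qed (intro linear_coface_coface linear_compose_neg)+

theorem theorem2p5:
  fixes V :: "'v set" and f g :: "'v \<Rightarrow> real" and n :: nat
  assumes "finite V"
  shows "(\<forall>i j. i < j \<and> j \<le> n \<longrightarrow>
           (\<forall>x\<in>path_space V (int n).
             (face V f i \<circ> face V g j) x = - (face V g (j - 1) \<circ> face V f i) x))
       \<and> (\<forall>i j. i \<le> n + 1 \<and> j \<le> n + 1 \<longrightarrow>
           (\<forall>x\<in>path_space V (int n).
             (face V f i \<circ> coface V g j) x =
               (if i < j then - (coface V g (j - 1) \<circ> face V f i) x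
                else if i = j then fun_inner V f g *\<^sub>R x
                else - (coface V g j \<circ> face V f (i - 1)) x)))
       \<and> (\<forall>i j. i \<le> j \<and> j \<le> n + 1 \<longrightarrow>
           (\<forall>x\<in>path_space V (int n).
             (coface V f i \<circ> coface V g j) x = - (coface V g (j + 1) \<circ> coface V f i) x))"
proof (intro conjI allI impI ballI)
  fix i j x
  assume "i < j \<and> j \<le> n" and x: "x \<in> path_space V (int n)"
  then obtain k where "j = Suc k" "i \<le> k" "Suc k \<le> n" by (cases j) auto
  with x show "(face V f i \<circ> face V g j) x = - (face V g (j - 1) \<circ> face V f i) x"
    using face_face[OF assms, of i k "int n" x f g] by simp
next
  fix i j x
  assume ij: "i \<le> n + 1 \<and> j \<le> n + 1" and x: "x \<in> path_space V (int n)"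
  consider k where "j = Suc k" "i \<le> k" | "i = j" | k where "i = Suc k" "j \<le> k"
    by (metis less_Suc_eq_le linorder_neqE_nat not0_implies_Suc not_less_zero)
  then show "(face V f i \<circ> coface V g j) x =
      (if i < j then - (coface V g (j - 1) \<circ> face V f i) x
       else if i = j then fun_inner V f g *\<^sub>R x
       else - (coface V g j \<circ> face V f (i - 1)) x)"
  proof cases
    case 1
    with ij x show ?thesis using face_coface_left[OF assms, of i k "int n" x f g] by simp
  next
    case 2
    with ij x show ?thesis using face_coface_same[OF assms, of i "int n" x f g] by simp
  next
    case 3
    with ij x show ?thesis using face_coface_right[OF assms, of j k "int n" x f g] by simp
  qed
next
  fix i j x
  assume "i \<le> j \<and> j \<le> n + 1" and "x \<in> path_space V (int n)"
  then show "(coface V f i \<circ> coface V g j) x = - (coface V g (j + 1) \<circ> coface V f i) x"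
    using coface_coface[of i j "int n" x V f g] by simp
qed

end
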